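(* Let $n\in\mathbb{N}^+$. For any $c\in\mathbb{R}$, the peaked function $$u(t,x)=\varphi_c(t,x)=a e^{-|x-ct|},\qquad\text{where } a\in\mathbb{R}\text{ and } c \text{ are related by } c=\left(1+\frac{1}{2n}\right)\sum_{k=0}^{n}\frac{(-1)^{k}}{2k+1}\binom{n}{k}a^{2n-1},$$ is a global weak solution (in the sense defined in the context, with initial data $u_0(x)=a e^{-|x|}$) of the equation $$m_t+(u^2-u_x^2)^{n-1}u_x m+\partial_x\left[(u^2-u_x^2)^{n-1}um\right]=0,\qquad m=u-u_{xx}.$$
   Context: $\mathbb{N}^+$ is the set of positive integers. Let $p(x)=\frac12 e^{-|x|}$, $x\in\mathbb{R}$, and let $*$ denote convolution in $x$. Weak solution: given initial data $u_0\in W^{1,2n}(\mathbb{R})$, a function $u(t,x)\in L^\infty_{loc}([0,T);W^{1,2n}_{loc}(\mathbb{R}))$ is called a weak solution of the equation on $[0,T)$ if $$\begin{aligned} &\int_0^T\!\!\int_{\mathbb{R}}\Bigg[u\phi_t+\frac{1}{2n}u^{2n}\phi_x+\left(\sum_{k=1}^{n-1}\frac{(-1)^{k+1}}{2k+1}\binom{n-1}{k}u^{2n-2k-1}u_x^{2k+1}\right)\phi\\ &\qquad+p*\left(u^{2n}+\sum_{k=1}^{n}\frac{(-1)^{k-1}(2n-2k+1)}{2n(2k-1)}\binom{n}{k}u^{2n-2k}u_x^{2k}\right)\cdot\partial_x\phi\\ &\qquad-p*\left(\sum_{k=1}^{n-1}\frac{(-1)^{k+1}}{2k+1}\binom{n-1}{k}u^{2n-2k-1}u_x^{2k+1}\right)\cdot\phi\Bigg]dx\,dt+\int_{\mathbb{R}}u_0(x)\phi(0,x)\,dx=0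 \end{aligned}$$ for every test function $\phi\in C_c^\infty([0,T)\times\mathbb{R})$. It is called a global weak solution if it is a weak solution on $[0,T)$ for every $T>0$. *)

theory Defs
  imports "HOL-Analysis.Analysis"
begin

section \<open>Test functions\<close>

definition Cc_infinity :: "(real \<Rightarrow> real) \<Rightarrow> bool" where
  "Cc_infinity \<psi> \<longleftrightarrow>
     (\<forall>k x. (deriv ^^ k) \<psi> differentiable (at x)) \<and> compact (closure {x. \<psi> x \<noteq> 0})"

text \<open>
  Functions \<open>\<phi> t x\<close> of time and space matter only for \<open>t \<ge> 0\<close>. The time derivative is taken
  within \<open>{0..}\<close>, so it is one-sided at \<open>t = 0\<close>.
\<close>

definition partial_t :: "(real \<Rightarrow> real \<Rightarrow> real) \<Rightarrow> real \<Rightarrow> real \<Rightarrow> real" where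
  "partial_t \<phi> t x = vector_derivative (\<lambda>s. \<phi> s x) (at t within {0..})"

definition partial_x :: "(real \<Rightarrow> real \<Rightarrow> real) \<Rightarrow> real \<Rightarrow> real \<Rightarrow> real" where
  "partial_x \<phi> t x = deriv (\<phi> t) x"

primrec Ck_halfplane :: "nat \<Rightarrow> (real \<Rightarrow> real \<Rightarrow> real) \<Rightarrow> bool" where
  "Ck_halfplane 0 \<phi> \<longleftrightarrow> continuous_on ({0..} \<times> UNIV) (\<lambda>(t, x). \<phi> t x)"
| "Ck_halfplane (Suc k) \<phi> \<longleftrightarrow>
     continuous_on ({0..} \<times> UNIV) (\<lambda>(t, x). \<phi> t x) \<and>
     (\<forall>t\<ge>0. \<forall>x. (\<lambda>s. \<phi> s x) differentiable (at t within {0..}) \<and> \<phi> t differentiable (at x)) \<and>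
     Ck_halfplane k (partial_t \<phi>) \<and> Ck_halfplane k (partial_x \<phi>)"

text \<open>
  The space \<open>C\<^sub>c\<^sup>\<infinity>([0,T) \<times> \<real>)\<close>. The support may meet the line \<open>t = 0\<close> but stays away from
  \<open>t = T\<close>; elements are identified with their smooth extension by zero to \<open>t \<ge> T\<close>.
\<close>

definition Cc_infinity_spacetime :: "real \<Rightarrow> (real \<Rightarrow> real \<Rightarrow> real) \<Rightarrow> bool" where
  "Cc_infinity_spacetime T \<phi> \<longleftrightarrow>
     (\<forall>k. Ck_halfplane k \<phi>) \<and>
     compact (closure {(t, x). 0 \<le> t \<and> \<phi> t x \<noteq> 0}) \<and>
     closure {(t, x). 0 \<le> t \<and> \<phi> t x \<noteq> 0} \<subseteq> {0..<T} \<times> UNIV"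


section \<open>Sobolev spaces on the real line\<close>

definition locally_integrable :: "(real \<Rightarrow> real) \<Rightarrow> bool" where
  "locally_integrable f \<longleftrightarrow> (\<forall>K. compact K \<longrightarrow> set_integrable lborel K f)"

definition has_weak_derivative :: "(real \<Rightarrow> real) \<Rightarrow> (real \<Rightarrow> real) \<Rightarrow> bool" where
  "has_weak_derivative f g \<longleftrightarrow>
     locally_integrable f \<and> locally_integrable g \<and>
     (\<forall>\<psi>. Cc_infinity \<psi> \<longrightarrow> (LBINT x. f x * deriv \<psi> x) = - (LBINT x. g x * \<psi> x))"

text \<open>Membership of \<open>f\<close> in \<open>W\<^sup>1\<^sup>,\<^sup>q(\<real>)\<close>.\<close>

definition sobolev_W1 :: "nat \<Rightarrow> (real \<Rightarrow> real) \<Rightarrow> bool" where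
  "sobolev_W1 q f \<longleftrightarrow>
     (\<exists>g. has_weak_derivative f g \<and>
          integrable lborel (\<lambda>x. \<bar>f x\<bar> ^ q) \<and> integrable lborel (\<lambda>x. \<bar>g x\<bar> ^ q))"

text \<open>
  Membership of \<open>u\<close> in \<open>L\<^sup>\<infinity>\<^sub>l\<^sub>o\<^sub>c([0,T); W\<^sup>1\<^sup>,\<^sup>q\<^sub>l\<^sub>o\<^sub>c(\<real>))\<close>, where \<open>v\<close> is a representative of the weak space
  derivative of \<open>u\<close>. Both are Borel representatives, jointly measurable in time and space. The
  last clause bounds the \<open>q\<close>-th power of the \<open>W\<^sup>1\<^sup>,\<^sup>q(L)\<close> norm of \<open>u t\<close> essentially uniformly in
  \<open>t \<in> K\<close>.
\<close>

definition Linf_loc_W1_loc ::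
  "nat \<Rightarrow> real \<Rightarrow> (real \<Rightarrow> real \<Rightarrow> real) \<Rightarrow> (real \<Rightarrow> real \<Rightarrow> real) \<Rightarrow> bool" where
  "Linf_loc_W1_loc q T u v \<longleftrightarrow>
     set_borel_measurable lborel ({0..<T} \<times> UNIV) (\<lambda>(t, x). u t x) \<and>
     set_borel_measurable lborel ({0..<T} \<times> UNIV) (\<lambda>(t, x). v t x) \<and>
     (AE t in lborel. t \<in> {0..<T} \<longrightarrow> has_weak_derivative (u t) (v t)) \<and>
     (\<forall>K L. compact K \<and> K \<subseteq> {0..<T} \<and> compact L \<longrightarrow>
        (\<exists>C. AE t in lborel. t \<in> K \<longrightarrow>
           set_integrable lborel L (\<lambda>x. \<bar>u t x\<bar> ^ q) \<and>
           set_integrable lborel L (\<lambda>x. \<bar>v t x\<bar> ^ q) \<and>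
           (LBINT x:L. \<bar>u t x\<bar> ^ q) + (LBINT x:L. \<bar>v t x\<bar> ^ q) \<le> C))"


section \<open>Weak solutions\<close>

definition peak_kernel :: "real \<Rightarrow> real" where
  "peak_kernel x = 1/2 * exp (- \<bar>x\<bar>)"

definition convolution_exists :: "(real \<Rightarrow> real) \<Rightarrow> (real \<Rightarrow> real) \<Rightarrow> bool" where
  "convolution_exists f g \<longleftrightarrow> (\<forall>x. integrable lborel (\<lambda>y. f (x - y) * g y))"

definition convolution :: "(real \<Rightarrow> real) \<Rightarrow> (real \<Rightarrow> real) \<Rightarrow> real \<Rightarrow> real" where
  "convolution f g x = (LBINT y. f (x - y) * g y)"

text \<open>
  The two nonlinearities as pointwise functions of \<open>u\<close> and \<open>v = u\<^sub>x\<close>. Since \<open>p * m = u\<close> for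
  \<open>m = u - u\<^sub>x\<^sub>x\<close>, convolving
  \<open>m\<^sub>t + (u\<^sup>2 - u\<^sub>x\<^sup>2)\<^sup>n\<^sup>-\<^sup>1 u\<^sub>x m + \<partial>\<^sub>x[(u\<^sup>2 - u\<^sub>x\<^sup>2)\<^sup>n\<^sup>-\<^sup>1 u m] = 0\<close> with \<open>p\<close> gives the nonlocal equation
  \<open>u\<^sub>t + u\<^sup>2\<^sup>n\<^sup>-\<^sup>1 u\<^sub>x - S + \<partial>\<^sub>x (p * F) + p * S = 0\<close>, with \<open>S\<close> the \<open>nonlin_S\<close> and \<open>F\<close> the \<open>nonlin_F\<close>
  below; its distributional form is what \<open>weak_solution\<close> states.
\<close>

definition nonlin_S :: "nat \<Rightarrow> real \<Rightarrow> real \<Rightarrow> real" where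
  "nonlin_S n u v =
     (\<Sum>k = 1..n - 1. (-1) ^ (k + 1) / (2 * real k + 1) * real ((n - 1) choose k) *
        u ^ (2 * n - 2 * k - 1) * v ^ (2 * k + 1))"

definition nonlin_F :: "nat \<Rightarrow> real \<Rightarrow> real \<Rightarrow> real" where
  "nonlin_F n u v =
     u ^ (2 * n) +
     (\<Sum>k = 1..n. (-1) ^ (k - 1) * (2 * real n - 2 * real k + 1) / (2 * real n * (2 * real k - 1)) *
        real (n choose k) * u ^ (2 * n - 2 * k) * v ^ (2 * k))"

definition weak_integrand ::
  "nat \<Rightarrow> (real \<Rightarrow> real \<Rightarrow> real) \<Rightarrow> (real \<Rightarrow> real \<Rightarrow> real) \<Rightarrow> (real \<Rightarrow> real \<Rightarrow> real) \<Rightarrow> real \<Rightarrow> real \<Rightarrow> real" where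
  "weak_integrand n u v \<phi> t x =
     u t x * partial_t \<phi> t x
     + 1 / (2 * real n) * u t x ^ (2 * n) * partial_x \<phi> t x
     + nonlin_S n (u t x) (v t x) * \<phi> t x
     + convolution peak_kernel (\<lambda>y. nonlin_F n (u t y) (v t y)) x * partial_x \<phi> t x
     - convolution peak_kernel (\<lambda>y. nonlin_S n (u t y) (v t y)) x * \<phi> t x"

text \<open>
  The weak space derivative \<open>v\<close> is determined up to null sets, and the conditions below do not
  depend on its choice. Bochner integrals of non-integrable functions are \<open>0\<close> by convention, so
  the existence of the convolutions and of the space-time integral is demanded explicitly.
\<close>

definition weak_solution ::
  "nat \<Rightarrow> real \<Rightarrow> (real \<Rightarrow> real) \<Rightarrow> (real \<Rightarrow> real \<Rightarrow> real) \<Rightarrow> bool" where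
  "weak_solution n T u0 u \<longleftrightarrow>
     sobolev_W1 (2 * n) u0 \<and>
     (\<exists>v. Linf_loc_W1_loc (2 * n) T u v \<and>
        (AE t in lborel. t \<in> {0..<T} \<longrightarrow>
           convolution_exists peak_kernel (\<lambda>y. nonlin_F n (u t y) (v t y)) \<and>
           convolution_exists peak_kernel (\<lambda>y. nonlin_S n (u t y) (v t y))) \<and>
        (\<forall>\<phi>. Cc_infinity_spacetime T \<phi> \<longrightarrow>
           set_integrable lborel ({0..<T} \<times> UNIV) (\<lambda>(t, x). weak_integrand n u v \<phi> t x) \<and>
           (LBINT t:{0..<T}. (LBINT x. weak_integrand n u v \<phi> t x)) + (LBINT x. u0 x * \<phi> 0 x) = 0))"

definition global_weak_solution ::
  "nat \<Rightarrow> (real \<Rightarrow> real) \<Rightarrow> (real \<Rightarrow> real \<Rightarrow> real) \<Rightarrow> bool" where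
  "global_weak_solution n u0 u \<longleftrightarrow> (\<forall>T>0. weak_solution n T u0 u)"

end

theory Submission
  imports Defs
begin

text \<open>
  Write \<open>e = exp (- \<bar>x - c t\<bar>)\<close> and let \<open>s\<close> be the sign of \<open>x - c t\<close>. Since \<open>u\<^sub>x = - s u\<close>, each
  nonlinearity collapses to a constant multiple of \<open>e\<^sup>2\<^sup>n\<close> or \<open>s e\<^sup>2\<^sup>n\<close>, the constants being
  expressed by \<open>I = \<integral>\<^sub>0\<^sup>1 (1 - y\<^sup>2)\<^sup>n\<^sup>-\<^sup>1 dy\<close>, and the speed is \<open>c = I a\<^sup>2\<^sup>n\<^sup>-\<^sup>1\<close>. The convolutions with \<open>p\<close>
  are explicit combinations of \<open>e\<close> and \<open>e\<^sup>2\<^sup>n\<close>, and the coefficients match so that the integrand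
  becomes \<open>u (\<phi>\<^sub>t + c \<phi>\<^sub>x) + (q \<phi>)\<^sub>x\<close> for a continuous, piecewise smooth \<open>q\<close>. The second term
  integrates to zero in \<open>x\<close>; in the moving coordinate the first is a total time derivative and
  leaves only the initial value.
\<close>

section \<open>Alternating binomial sums\<close>

text \<open>Expanding the integrand shows that \<open>peakon_sum n\<close> is \<open>\<integral>\<^sub>0\<^sup>1 (1 - y\<^sup>2)\<^sup>n\<^sup>-\<^sup>1 dy\<close>.\<close>

definition peakon_sum :: "nat \<Rightarrow> real" where
  "peakon_sum n = (\<Sum>k = 0..n - 1. (-1) ^ k / (2 * real k + 1) * real ((n - 1) choose k))"

text \<open>This is the reduction formula (2 n + 1) I(n + 1) = 2 n I(n) for the integrals behind
  \<open>peakon_sum\<close>. Termwise, (2 n + 1)/(2 k + 1) = 1 + 2 (n - k)/(2 k + 1): the 1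
  contributes an alternating row sum, zero for \<open>n \<ge> 1\<close>, and the factor n - k is
  absorbed by passing to row n - 1.\<close>

lemma peakon_sum_recurrence:
  fixes n :: nat
  assumes "n \<ge> 1"
  shows "(2 * real n + 1) * (\<Sum>k = 0..n. (-1) ^ k / (2 * real k + 1) * real (n choose k)) =
    2 * real n * peakon_sum n"
proof -
  have "(2 * real n + 1) * (\<Sum>k = 0..n. (-1) ^ k / (2 * real k + 1) * real (n choose k)) =
     (\<Sum>k\<le>n. (-1) ^ k * real (n choose k)
        + 2 * real n * ((-1) ^ k / (2 * real k + 1) * real ((n - 1) choose k)))"
    unfolding sum_distrib_left atMost_atLeast0
  proof (rule sum.cong[OF refl])
    fix k assume k: "k \<in> {0..n}"
    have "real ((n - k) * (n choose k)) = real (n * ((n - 1) choose k))"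
      using binomial_absorb_comp by metis
    then have absorb: "real n * real ((n - 1) choose k) = (real n - real k) * real (n choose k)"
      using k by (simp add: of_nat_diff)
    have *: "2 * real n * ((-1) ^ k / (2 * real k + 1) * real ((n - 1) choose k)) =
        2 * ((-1) ^ k / (2 * real k + 1)) * ((real n - real k) * real (n choose k))"
      by (simp flip: absorb)
    show "(2 * real n + 1) * ((-1) ^ k / (2 * real k + 1) * real (n choose k)) =
      (-1) ^ k * real (n choose k)
        + 2 * real n * ((-1) ^ k / (2 * real k + 1) * real ((n - 1) choose k))"
      unfolding * by (simp add: divide_simps) (simp add: algebra_simps)
  qed
  also have "\<dots> = 2 * real n * (\<Sum>k\<le>n. (-1) ^ k / (2 * real k + 1) * real ((n - 1) choose k))"
    using choose_alternating_sum[of n, where ?'a = real] assms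
    by (simp add: sum.distrib sum_distrib_left)
  \<comment> \<open>The additional term \<open>k = n\<close> carries the binomial
    \<open>(n - 1) choose n\<close>, which is zero.\<close>
  also have "(\<Sum>k\<le>n. (-1) ^ k / (2 * real k + 1) * real ((n - 1) choose k)) =
      (\<Sum>k = 0..n - 1. (-1) ^ k / (2 * real k + 1) * real ((n - 1) choose k))"
    using assms by (intro sum.mono_neutral_right) auto
  finally show ?thesis by (simp only: peakon_sum_def)
qed

text \<open>The summands are the coefficients of the sum in \<open>nonlin_F\<close>, which add up
  once u_x^2 = u^2. After shifting k by one, the rational factor is 1/(2 k + 1) - 1/(2 n) = (2 k +
  2)/(2 k + 1) - (1 + 1/(2 n)); absorption moves the first part to row n - 1, and the second
  multiplies an alternating sum.\<close>

lemma peakon_sum_shifted: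
  fixes n :: nat
  assumes "n \<ge> 1"
  shows "(\<Sum>k = 1..n. (-1) ^ (k - 1) * (2 * real n - 2 * real k + 1) / (2 * real n * (2 * real k - 1))
            * real (n choose k)) =
    2 * real n * peakon_sum n - 1 - 1 / (2 * real n)"
proof -
  obtain N where n: "n = Suc N" using assms by (cases n) auto
  \<comment> \<open>The alternating sum over the whole row is zero, so the terms after the leading 1
    sum to -1; the index shift flips the sign.\<close>
  have alt: "(\<Sum>k = 0..N. (-1) ^ k * real (Suc N choose Suc k)) = 1"
    using choose_alternating_sum[of "Suc N", where ?'a = real]
    unfolding sum.atMost_Suc_shift by (simp add: atMost_atLeast0 sum_negf del: binomial_Suc_Suc)
  have "(\<Sum>k = 1..n. (-1) ^ (k - 1) * (2 * real n - 2 * real k + 1) / (2 * real n * (2 * real k - 1))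
            * real (n choose k)) =
     (\<Sum>k = 0..N. (-1) ^ k * (2 * real n - 2 * real (Suc k) + 1) / (2 * real n * (2 * real (Suc k) - 1))
            * real (n choose Suc k))"
    unfolding n One_nat_def sum.atLeast_Suc_atMost_Suc_shift by (simp add: algebra_simps)
  also have "\<dots> = (\<Sum>k = 0..N. 2 * real n * ((-1) ^ k / (2 * real k + 1) * real (N choose k))
      - (1 + 1 / (2 * real n)) * ((-1) ^ k * real (Suc N choose Suc k)))"
  proof (rule sum.cong[OF refl])
    fix k assume "k \<in> {0..N}"
    have "real (Suc k * (Suc N choose Suc k)) = real (Suc N * (N choose k))"
      by (simp only: Suc_times_binomial_eq mult.commute)
    then have absorb: "real n * real (N choose k) = (real k + 1) * real (Suc N choose Suc k)"
      using n by (simp add: algebra_simps del: binomial_Suc_Suc)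
    have *: "2 * real n * ((-1) ^ k / (2 * real k + 1) * real (N choose k)) =
        2 * ((-1) ^ k / (2 * real k + 1)) * ((real k + 1) * real (Suc N choose Suc k))"
      by (simp flip: absorb del: binomial_Suc_Suc)
    show "(-1) ^ k * (2 * real n - 2 * real (Suc k) + 1) / (2 * real n * (2 * real (Suc k) - 1))
            * real (n choose Suc k) = 2 * real n * ((-1) ^ k / (2 * real k + 1) * real (N choose k))
      - (1 + 1 / (2 * real n)) * ((-1) ^ k * real (Suc N choose Suc k))"
      unfolding * unfolding n by (simp add: divide_simps del: binomial_Suc_Suc) (simp add: algebra_simps del: binomial_Suc_Suc)
  qed
  also have "\<dots> = 2 * real n * (\<Sum>k = 0..N. (-1) ^ k / (2 * real k + 1) * real (N choose k))
     - (1 + 1 / (2 * real n))"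
    unfolding sum_subtractf sum_distrib_left[symmetric] alt by simp
  finally show ?thesis by (simp add: n peakon_sum_def)
qed

section \<open>Integration on the real line\<close>

text \<open>The set \<open>S\<close> accommodates the crest, where derivatives fail; continuity of
  \<open>F\<close> rules out jump contributions there. Integrability of \<open>f\<close> lets
  dominated convergence pass from \<open>{- k..k}\<close> to the whole line.\<close>

lemma integral_real_line_FTC:
  fixes f F :: "real \<Rightarrow> real"
  assumes int: "integrable lborel f" and S: "finite S"
    and cont: "continuous_on UNIV F"
    and deriv: "\<And>x. x \<notin> S \<Longrightarrow> (F has_real_derivative f x) (at x)"
    and lim: "(F \<longlongrightarrow> l) at_bot" "(F \<longlongrightarrow> L) at_top"
  shows "(LBINT x. f x) = L - l"
proof -
  have "(LBINT x:{- real k..real k}. f x) = F (real k) - F (- real k)" for k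
  proof -
    have "(f has_integral F (real k) - F (- real k)) {- real k..real k}"
      by (rule fundamental_theorem_of_calculus_interior_strong[OF S])
        (auto intro!: continuous_on_subset[OF cont] deriv
          simp flip: has_real_derivative_iff_has_vector_derivative)
    moreover have "set_integrable lborel {- real k..real k} f"
      using int unfolding set_integrable_def by (intro integrable_mult_indicator) auto
    ultimately show ?thesis
      by (metis set_borel_integral_eq_integral(2) integral_unique)
  qed
  moreover have "(\<lambda>k. F (real k) - F (- real k)) \<longlonglongrightarrow> L - l"
    by (intro tendsto_diff filterlim_compose[OF lim(2)] filterlim_compose[OF lim(1)]
        filterlim_real_sequentially filterlim_compose[OF filterlim_uminus_at_bot_at_top])
  moreover have "(\<lambda>k. LBINT x:{- real k..real k}. f x) \<longlonglongrightarrow> (LBINT x. f x)"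
    unfolding set_lebesgue_integral_def
  proof (rule integral_dominated_convergence[where w = "\<lambda>x. norm (f x)"])
    show "AE x in lborel. (\<lambda>k. indicator {- real k..real k} x *\<^sub>R f x) \<longlonglongrightarrow> f x"
    proof (rule AE_I2, rule tendsto_eventually)
      fix x :: real
      obtain N :: nat where "\<bar>x\<bar> \<le> real N" using real_arch_simple by blast
      then show "\<forall>\<^sub>F k in sequentially. indicator {- real k..real k} x *\<^sub>R f x = f x"
        by (intro eventually_sequentiallyI[of N]) (auto simp: indicator_def)
    qed
  qed (use int in \<open>auto simp: indicator_def\<close>)
  ultimately show ?thesis by (auto dest: LIMSEQ_unique)
qed

lemma integrable_mult_bounded:
  fixes f g :: "'a \<Rightarrow> real"
  assumes "integrable M f" "g \<in> borel_measurable M" "\<And>x. \<bar>g x\<bar> \<le> B"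
  shows "integrable M (\<lambda>x. f x * g x)"
proof (rule Bochner_Integration.integrable_bound)
  show "integrable M (\<lambda>x. B * f x)" using assms by simp
  have "\<bar>f x * g x\<bar> \<le> \<bar>B * f x\<bar>" for x
    using mult_left_mono[OF assms(3)[of x], of "\<bar>f x\<bar>"] assms(3)[of x]
    by (simp add: abs_mult mult.commute)
  then show "AE x in M. norm (f x * g x) \<le> norm (B * f x)" by simp
qed (use assms in measurable)

lemma integrable_exp_minus_abs: "integrable lborel (\<lambda>x::real. exp (- \<bar>x - s\<bar>))"
proof -
  \<comment> \<open>Nonnegativity upgrades gauge integrability on the half-line to Lebesgue
    integrability.\<close>
  have "(\<lambda>x::real. exp (- x)) absolutely_integrable_on {0..}"
    using has_integral_exp_minus_to_infinity[of 1 0]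
    by (intro nonnegative_absolutely_integrable_1) (auto simp: integrable_on_def)
  then have 1: "integrable lborel (\<lambda>x::real. indicator {0..} x * exp (- x))"
    unfolding set_integrable_def
    by (subst (asm) integrable_completion) (auto)
  have 2: "integrable lborel (\<lambda>x::real. indicator {0..} (- x) * exp x)"
    using lborel_integrable_real_affine[OF 1, of "-1" 0] by simp
  \<comment> \<open>The two halves overlap at 0, so their sum serves as a majorant and not as an
    equal function.\<close>
  have "integrable lborel (\<lambda>x::real. exp (- \<bar>x\<bar>))"
    by (rule Bochner_Integration.integrable_bound[OF Bochner_Integration.integrable_add[OF 1 2]])
      (auto simp: indicator_def)
  from lborel_integrable_real_affine[OF this, of 1 "-s"] show ?thesis by simp
qed

section \<open>Convolution with the peak kernel\<close>

text \<open>Unlike \<open>sgn\<close>, never zero, so that \<open>(side x)\<^sup>2 = 1\<close> also at the crest.\<close>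

definition side :: "real \<Rightarrow> real" where
  "side x = (if x \<ge> 0 then 1 else -1)"

lemma side_measurable [measurable]: "side \<in> borel_measurable borel"
  unfolding side_def by measurable

lemma abs_side [simp]: "\<bar>side x\<bar> = 1"
  by (simp add: side_def)

lemma side_mult_side [simp]: "side x * (side x * y) = y"
  by (simp add: side_def)

lemma side_power_even: "side x ^ (2 * k) = 1"
  by (simp add: side_def)

lemma exp_minus_abs_power: "exp (- \<bar>x\<bar>) ^ m = exp (- real m * \<bar>x::real\<bar>)"
  by (simp flip: exp_of_nat_mult)

lemma DERIV_abs_side:
  fixes x :: real
  assumes "x \<noteq> 0"
  shows "(abs has_real_derivative side x) (at x)"
proof (rule has_field_derivative_transform_within_open
    [where f = "\<lambda>y. side x * y" and S = "if x > 0 then {0<..} else {..<0}"])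
  show "((\<lambda>y. side x * y) has_real_derivative side x) (at x)"
    by (auto intro!: derivative_eq_intros)
qed (use assms in \<open>auto simp: side_def split: if_splits\<close>)

lemma DERIV_exp_abs_power:
  assumes "x \<noteq> s"
  shows "((\<lambda>x. exp (- \<bar>x - s\<bar>) ^ m) has_real_derivative
    - side (x - s) * real m * exp (- \<bar>x - s\<bar>) ^ m) (at x)"
  unfolding exp_minus_abs_power using assms
  by (auto intro!: derivative_eq_intros DERIV_chain2[OF DERIV_abs_side])

text \<open>Away from the crest \<open>side\<close> is locally constant, so it passes through the
  derivative as a scalar.\<close>

lemma DERIV_side_mult:
  assumes "(g has_real_derivative D) (at x)" "x \<noteq> s"
  shows "((\<lambda>x. side (x - s) * g x) has_real_derivative side (x - s) * D) (at x)"
proof (rule has_field_derivative_transform_within_open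
    [where f = "\<lambda>y. side (x - s) * g y" and S = "if x > s then {s<..} else {..<s}"])
  show "((\<lambda>y. side (x - s) * g y) has_real_derivative side (x - s) * D) (at x)"
    using assms by (auto intro!: derivative_eq_intros)
qed (use assms in \<open>auto simp: side_def split: if_splits\<close>)

text \<open>The jump of \<open>side\<close> at \<open>s\<close> is multiplied by
  \<open>g s = 0\<close>, so the two branches glue.\<close>

lemma continuous_on_side_mult:
  assumes "continuous_on UNIV g" "g s = 0"
  shows "continuous_on UNIV (\<lambda>x. side (x - s) * g x)"
proof -
  have "continuous_on ({s..} \<union> {..s}) (\<lambda>x. if s \<le> x then g x else - g x)"
    using assms(2)
    by (intro continuous_on_If) 
       (auto intro!: continuous_intros continuous_on_subset[OF assms(1)])
  also have "{s..} \<union> {..s} = UNIV" by auto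
  also have "(\<lambda>x. if s \<le> x then g x else - g x) = (\<lambda>x. side (x - s) * g x)"
    by (auto simp: side_def)
  finally show ?thesis .
qed

lemma integrable_peak_kernel_mult:
  assumes "f \<in> borel_measurable borel" "\<And>x. \<bar>f x\<bar> \<le> B"
  shows "integrable lborel (\<lambda>y. peak_kernel (x - y) * f y)"
proof -
  have "integrable lborel (\<lambda>y. 1/2 * (exp (- \<bar>y - x\<bar>) * f y))"
    using assms by (intro integrable_mult_right integrable_mult_bounded[OF integrable_exp_minus_abs]) auto
  then show ?thesis
    by (simp add: peak_kernel_def abs_minus_commute mult.assoc)
qed

text \<open>
  If \<open>w - w'' = f\<close> and \<open>w'\<close> has no jumps, then \<open>w = p * f\<close>: the integrand \<open>p (x - y) f y\<close> has the
  antiderivative \<open>e\<^sup>y\<^sup>-\<^sup>x (w - w') / 2\<close> for \<open>y < x\<close> and \<open>- e\<^sup>x\<^sup>-\<^sup>y (w + w') / 2\<close> for \<open>y > x\<close>, whose jump at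
  \<open>y = x\<close> is \<open>- w x\<close>.
\<close>

lemma convolution_peak_kernel_eqI:
  fixes w w' f :: "real \<Rightarrow> real"
  assumes f: "f \<in> borel_measurable borel" "\<And>x. \<bar>f x\<bar> \<le> B"
    and cont: "continuous_on UNIV w" "continuous_on UNIV w'"
    and bound: "\<And>x. \<bar>w x\<bar> \<le> C" "\<And>x. \<bar>w' x\<bar> \<le> C"
    and S: "finite S"
    and deriv: "\<And>x. x \<notin> S \<Longrightarrow> (w has_real_derivative w' x) (at x)"
      "\<And>x. x \<notin> S \<Longrightarrow> (w' has_real_derivative w x - f x) (at x)"
  shows "convolution peak_kernel f x = w x"
proof -
  define P where "P y = 1/2 * exp (y - x) * (w y - w' y)" for y
  \<comment> \<open>The constant \<open>w x\<close> makes \<open>P\<close> and \<open>Q\<close>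
    agree at \<open>y = x\<close>, and it is what remains of \<open>Q\<close> as \<open>y\<close>
    tends to infinity.\<close>
  define Q where "Q y = w x - 1/2 * exp (x - y) * (w y + w' y)" for y
  have contP: "continuous_on A P" and contQ: "continuous_on A Q" for A
    unfolding P_def Q_def
    by (auto intro!: continuous_intros continuous_on_subset[OF cont(1)] continuous_on_subset[OF cont(2)])
  let ?F = "\<lambda>y. if y \<le> x then P y else Q y"
  have "(LBINT y. peak_kernel (x - y) * f y) = w x - 0"
  proof (rule integral_real_line_FTC[where S = "insert x S" and F = ?F])
    show "integrable lborel (\<lambda>y. peak_kernel (x - y) * f y)"
      by (rule integrable_peak_kernel_mult[OF f])
    have "continuous_on ({..x} \<union> {x..}) ?F"
      by (intro continuous_on_If contP contQ) (auto simp: P_def Q_def field_simps)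
    also have "{..x} \<union> {x..} = UNIV" by auto
    finally show "continuous_on UNIV ?F" .
    show "(?F has_real_derivative peak_kernel (x - y) * f y) (at y)" if y: "y \<notin> insert x S" for y
    proof (cases "y < x")
      case True
      \<comment> \<open>Differentiating the exponential gives \<open>w - w'\<close>, differentiating
        the bracket gives \<open>w' - w + f\<close>; only \<open>f\<close> survives. For
        \<open>Q\<close> the cancellation is the same up to sign.\<close>
      have "(P has_real_derivative peak_kernel (x - y) * f y) (at y)"
        unfolding P_def using y True
        by (auto intro!: derivative_eq_intros deriv simp: peak_kernel_def algebra_simps)
      then show ?thesis
        by (rule has_field_derivative_transform_within_open[where S = "{..<x}"]) (use True in auto)
    next
      case False
      have "(Q has_real_derivative peak_kernel (x - y) * f y) (at y)"
        unfolding Q_def using y False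
        by (auto intro!: derivative_eq_intros deriv simp: peak_kernel_def algebra_simps)
      then show ?thesis
        by (rule has_field_derivative_transform_within_open[where S = "{x<..}"]) (use False y in auto)
    qed
    \<comment> \<open>Boundedness of \<open>w\<close> and \<open>w'\<close> enters here: the
      exponential then forces decay, which excludes adding growing homogeneous solutions to
      \<open>w\<close>.\<close>
    have "((\<lambda>y. 1/2 * exp (y - x) * (w y - w' y)) \<longlongrightarrow> 0) at_bot"
    proof (rule Lim_null_comparison)
      show "\<forall>\<^sub>F y in at_bot. norm (1/2 * exp (y - x) * (w y - w' y)) \<le> C * exp (y - x)"
      proof (rule always_eventually, rule allI)
        fix y
        have "\<bar>w y - w' y\<bar> \<le> 2 * C" using bound[of y] by linarith
        from mult_left_mono[OF this, of "1/2 * exp (y - x)"]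
        show "norm (1/2 * exp (y - x) * (w y - w' y)) \<le> C * exp (y - x)"
          by (simp add: abs_mult mult_ac)
      qed
      have "((\<lambda>y. C * (exp (- x) * exp y)) \<longlongrightarrow> C * (exp (- x) * 0)) at_bot"
        by (intro tendsto_intros exp_at_bot)
      then show "((\<lambda>y. C * exp (y - x)) \<longlongrightarrow> 0) at_bot"
        by (simp add: exp_diff exp_minus field_simps)
    qed
    then show "(?F \<longlongrightarrow> 0) at_bot"
      by (rule Lim_transform_eventually)
        (auto simp: P_def intro: eventually_mono[OF eventually_le_at_bot[of x]])
    have "((\<lambda>y. 1/2 * exp (x - y) * (w y + w' y)) \<longlongrightarrow> 0) at_top"
    proof (rule Lim_null_comparison)
      show "\<forall>\<^sub>F y in at_top. norm (1/2 * exp (x - y) * (w y + w' y)) \<le> C * exp (x - y)"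
      proof (rule always_eventually, rule allI)
        fix y
        have "\<bar>w y + w' y\<bar> \<le> 2 * C" using bound[of y] by linarith
        from mult_left_mono[OF this, of "1/2 * exp (x - y)"]
        show "norm (1/2 * exp (x - y) * (w y + w' y)) \<le> C * exp (x - y)"
          by (simp add: abs_mult mult_ac)
      qed
      have "((\<lambda>y. C * (exp x * exp (- y))) \<longlongrightarrow> C * (exp x * 0)) at_top"
        by (intro tendsto_intros filterlim_compose[OF exp_at_bot filterlim_uminus_at_bot_at_top])
      then show "((\<lambda>y. C * exp (x - y)) \<longlongrightarrow> 0) at_top"
        by (simp add: exp_diff exp_minus field_simps)
    qed
    then have "(Q \<longlongrightarrow> w x - 0) at_top"
      unfolding Q_def by (intro tendsto_intros)
    then have "(Q \<longlongrightarrow> w x) at_top" by simp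
    then show "(?F \<longlongrightarrow> w x) at_top"
      by (rule Lim_transform_eventually)
        (auto intro: eventually_mono[OF eventually_gt_at_top[of x]])
  qed (use S in auto)
  then show ?thesis by (simp add: convolution_def)
qed

lemma exp_minus_abs_power_le: "exp (- \<bar>x::real\<bar>) ^ m \<le> 1"
  by (simp add: power_le_one)

text \<open>Off the crest, w - w'' sends \<open>e\<close> to 0 and \<open>e ^ m\<close> to
  \<open>(1 - m^2) * e ^ m\<close>, so \<open>- e ^ m / (m^2 - 1)\<close> is a particular solution.
  The multiple of \<open>e\<close> added to it is the one for which w' vanishes at the crest, so
  that its sign change causes no jump. The value \<open>m = 1\<close> would be resonant.\<close>

lemma peak_kernel_exp_power:
  fixes m :: nat
  assumes "m \<ge> 2"
  shows "convolution peak_kernel (\<lambda>y. exp (- \<bar>y - s\<bar>) ^ m) x =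
    (real m * exp (- \<bar>x - s\<bar>) - exp (- \<bar>x - s\<bar>) ^ m) / (real m ^ 2 - 1)"
proof -
  let ?D = "real m ^ 2 - 1" and ?e = "\<lambda>x. exp (- \<bar>x - s\<bar>)"
  have "1 < real m ^ 2" using assms by (intro one_less_power) auto
  then have D: "?D > 0" by simp
  have e: "0 \<le> ?e x ^ k" "?e x ^ k \<le> 1" for x k
    using exp_minus_abs_power_le by auto
  note e' = e[of _ 1, unfolded power_one_right]
  note deriv_e = DERIV_exp_abs_power[of _ s 1, unfolded power_one_right]
  have bound: "\<bar>p - q\<bar> \<le> real m" if "0 \<le> p" "p \<le> real m" "0 \<le> q" "q \<le> 1" for p q :: real
    using that assms by linarith
  show ?thesis
  proof (rule convolution_peak_kernel_eqI[where f = "\<lambda>y. ?e y ^ m" and B = 1 and S = "{s}"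
        and w = "\<lambda>x. (real m * ?e x - ?e x ^ m) / ?D"
        and w' = "\<lambda>x. side (x - s) * (real m * (?e x ^ m - ?e x) / ?D)"
        and C = "real m / ?D"])
    show "continuous_on UNIV (\<lambda>x. side (x - s) * (real m * (?e x ^ m - ?e x) / ?D))"
      by (rule continuous_on_side_mult) (use D in \<open>auto intro!: continuous_intros\<close>)
    show "\<bar>(real m * ?e x - ?e x ^ m) / ?D\<bar> \<le> real m / ?D" for x
      using D e e'[of x] by (auto simp: abs_divide intro!: divide_right_mono bound mult_left_le)
    show "\<bar>side (x - s) * (real m * (?e x ^ m - ?e x) / ?D)\<bar> \<le> real m / ?D" for x
    proof -
      have "\<bar>?e x ^ m - ?e x\<bar> \<le> 1" using e[of x m] e'[of x] by linarith
      then show ?thesis using D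
        by (auto simp: abs_mult abs_divide intro!: divide_right_mono mult_left_le)
    qed
    show "((\<lambda>x. (real m * ?e x - ?e x ^ m) / ?D) has_real_derivative
        side (x - s) * (real m * (?e x ^ m - ?e x) / ?D)) (at x)" if "x \<notin> {s}" for x
      using that D
      by (intro DERIV_cong[OF DERIV_cdivide[OF DERIV_diff[OF DERIV_cmult[OF deriv_e] DERIV_exp_abs_power]]]) (auto simp: field_simps)
    show "((\<lambda>x. side (x - s) * (real m * (?e x ^ m - ?e x) / ?D)) has_real_derivative
        (real m * ?e x - ?e x ^ m) / ?D - ?e x ^ m) (at x)" if "x \<notin> {s}" for x
    proof -
      have "((\<lambda>x. real m * (?e x ^ m - ?e x) / ?D) has_real_derivative
          side (x - s) * (real m * ?e x - real m ^ 2 * ?e x ^ m) / ?D) (at x)"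
        using that D
        by (intro DERIV_cong[OF DERIV_cdivide[OF DERIV_cmult[OF DERIV_diff[OF DERIV_exp_abs_power deriv_e]]]]) (auto simp: field_simps power2_eq_square)
      from DERIV_side_mult[OF this, of s]
      have "((\<lambda>x. side (x - s) * (real m * (?e x ^ m - ?e x) / ?D)) has_real_derivative
          (real m * ?e x - real m ^ 2 * ?e x ^ m) / ?D) (at x)"
        using that by (simp flip: times_divide_eq_right)
      \<comment> \<open>Writing \<open>m^2 = ?D + 1\<close> splits off exactly the source
        term.\<close>
      also have "(real m * ?e x - real m ^ 2 * ?e x ^ m) / ?D = (real m * ?e x - ?e x ^ m) / ?D - ?e x ^ m"
        using D by (simp add: field_simps)
      finally show ?thesis .
    qed
  qed (use D e in \<open>auto intro!: continuous_intros\<close>)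
qed

text \<open>The source is odd about \<open>s\<close>, so the roles are exchanged: the homogeneous
  term now has coefficient 1, which makes w itself vanish at the crest, and w' is even and
  continuous without further adjustment.\<close>

lemma peak_kernel_side_exp_power:
  fixes m :: nat
  assumes "m \<ge> 2"
  shows "convolution peak_kernel (\<lambda>y. side (y - s) * exp (- \<bar>y - s\<bar>) ^ m) x =
    side (x - s) * ((exp (- \<bar>x - s\<bar>) - exp (- \<bar>x - s\<bar>) ^ m) / (real m ^ 2 - 1))"
proof -
  let ?D = "real m ^ 2 - 1" and ?e = "\<lambda>x. exp (- \<bar>x - s\<bar>)"
  have "1 < real m ^ 2" using assms by (intro one_less_power) auto
  then have D: "?D > 0" by simp
  have e: "0 \<le> ?e x ^ k" "?e x ^ k \<le> 1" for x k
    using exp_minus_abs_power_le by auto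
  note e' = e[of _ 1, unfolded power_one_right]
  note deriv_e = DERIV_exp_abs_power[of _ s 1, unfolded power_one_right]
  have bound: "\<bar>p - q\<bar> \<le> real m" if "0 \<le> p" "p \<le> real m" "0 \<le> q" "q \<le> 1" for p q :: real
    using that assms by linarith
  show ?thesis
  proof (rule convolution_peak_kernel_eqI[where f = "\<lambda>y. side (y - s) * ?e y ^ m" and B = 1 and S = "{s}"
        and w = "\<lambda>x. side (x - s) * ((?e x - ?e x ^ m) / ?D)"
        and w' = "\<lambda>x. (real m * ?e x ^ m - ?e x) / ?D"
        and C = "real m / ?D"])
    show "continuous_on UNIV (\<lambda>x. side (x - s) * ((?e x - ?e x ^ m) / ?D))"
      by (rule continuous_on_side_mult) (use D in \<open>auto intro!: continuous_intros\<close>)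
    show "\<bar>(real m * ?e x ^ m - ?e x) / ?D\<bar> \<le> real m / ?D" for x
      using D e e'[of x] by (auto simp: abs_divide intro!: divide_right_mono bound mult_left_le)
    show "\<bar>side (x - s) * ((?e x - ?e x ^ m) / ?D)\<bar> \<le> real m / ?D" for x
    proof -
      have "\<bar>?e x - ?e x ^ m\<bar> \<le> real m" using e[of x m] e'[of x] assms by linarith
      then show ?thesis using D
        by (auto simp: abs_mult abs_divide intro!: divide_right_mono)
    qed
    show "((\<lambda>x. side (x - s) * ((?e x - ?e x ^ m) / ?D)) has_real_derivative
        (real m * ?e x ^ m - ?e x) / ?D) (at x)" if "x \<notin> {s}" for x
    proof -
      have "((\<lambda>x. (?e x - ?e x ^ m) / ?D) has_real_derivative
          side (x - s) * (real m * ?e x ^ m - ?e x) / ?D) (at x)"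
        using that D
        by (intro DERIV_cong[OF DERIV_cdivide[OF DERIV_diff[OF deriv_e DERIV_exp_abs_power]]]) (auto simp: field_simps)
      from DERIV_side_mult[OF this, of s]
      show ?thesis
        using that by (simp flip: times_divide_eq_right)
    qed
    show "((\<lambda>x. (real m * ?e x ^ m - ?e x) / ?D) has_real_derivative
        side (x - s) * ((?e x - ?e x ^ m) / ?D) - side (x - s) * ?e x ^ m) (at x)" if "x \<notin> {s}" for x
    proof -
      have "((\<lambda>x. (real m * ?e x ^ m - ?e x) / ?D) has_real_derivative
        side (x - s) * ((?e x - real m ^ 2 * ?e x ^ m) / ?D)) (at x)"
        using that D
        by (intro DERIV_cong[OF DERIV_cdivide[OF DERIV_diff[OF DERIV_cmult[OF DERIV_exp_abs_power] deriv_e]]]) (auto simp: field_simps power2_eq_square)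
      also have "(?e x - real m ^ 2 * ?e x ^ m) / ?D = (?e x - ?e x ^ m) / ?D - ?e x ^ m"
        using D by (simp add: field_simps)
      finally show ?thesis by (simp add: right_diff_distrib)
    qed
    show "\<bar>side (x - s) * ?e x ^ m\<bar> \<le> 1" for x using e[of x m] by (simp add: abs_mult)
  qed (use D in \<open>auto intro!: continuous_intros\<close>)
qed

section \<open>Test functions\<close>

lemma integrable_imp_locally_integrable:
  "integrable lborel f \<Longrightarrow> locally_integrable f"
  unfolding locally_integrable_def set_integrable_def
  by (intro allI impI integrable_mult_indicator) (simp_all add: borel_compact)

lemma integrable_mult_compact_support:
  fixes f g :: "real \<Rightarrow> real"
  assumes f: "f \<in> borel_measurable borel" "\<And>x. \<bar>f x\<bar> \<le> B"
    and g: "continuous_on UNIV g" "\<And>x. \<bar>x\<bar> > R \<Longrightarrow> g x = 0"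
  shows "integrable lborel (\<lambda>x. f x * g x)"
proof -
  have "integrable lborel (\<lambda>x. indicator {-R..R} x *\<^sub>R g x)"
    by (intro borel_integrable_compact continuous_on_subset[OF g(1)]) auto
  also have "(\<lambda>x. indicator {-R..R} x *\<^sub>R g x) = g"
  proof
    fix x
    show "indicator {-R..R} x *\<^sub>R g x = g x"
      using g(2)[of x] by (cases "\<bar>x\<bar> > R") (auto simp: indicator_def)
  qed
  finally have "integrable lborel (\<lambda>x. g x * f x)"
    by (rule integrable_mult_bounded) (use f in auto)
  then show ?thesis by (simp add: mult.commute)
qed

text \<open>The factor \<open>f\<close> may jump along the crest line, hence Borel and bounded;
  \<open>g\<close> carries the continuity and the spatial cutoff.\<close>

lemma set_integrable_mult_compact_support:
  fixes f g :: "real \<times> real \<Rightarrow> real"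
  assumes f: "f \<in> borel_measurable borel" "\<And>z. \<bar>f z\<bar> \<le> B"
    and g: "continuous_on ({0..} \<times> UNIV) g" "\<And>t x. 0 \<le> t \<Longrightarrow> t < T \<Longrightarrow> \<bar>x\<bar> > R \<Longrightarrow> g (t, x) = 0"
  shows "set_integrable lborel ({0..<T} \<times> UNIV) (\<lambda>z. f z * g z)"
proof -
  let ?A = "{0..<T} \<times> (UNIV :: real set)"
  \<comment> \<open>The closed rectangle is compact and lies in the half-plane where
    \<open>g\<close> is continuous; on the half-open strip this cutoff changes nothing.\<close>
  have "integrable lborel (\<lambda>z. indicator ({0..T} \<times> {-R..R}) z *\<^sub>R g z)"
    by (intro borel_integrable_compact continuous_on_subset[OF g(1)] compact_Times) auto
  moreover have "?A \<in> sets (borel :: (real \<times> real) measure)"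
    by (intro borel_Times) auto
  ultimately have "set_integrable lborel ?A (\<lambda>z. indicator ({0..T} \<times> {-R..R}) z *\<^sub>R g z)"
    unfolding set_integrable_def by (intro integrable_mult_indicator[where A = ?A]) auto
  then have "integrable lborel (\<lambda>z. indicator ?A z *\<^sub>R indicator ({0..T} \<times> {-R..R}) z *\<^sub>R g z)"
    by (simp only: set_integrable_def)
  also have "(\<lambda>z. indicator ?A z *\<^sub>R indicator ({0..T} \<times> {-R..R}) z *\<^sub>R g z) =
      (\<lambda>z. indicator ?A z *\<^sub>R g z)"
  proof
    fix z :: "real \<times> real"
    show "indicator ?A z *\<^sub>R indicator ({0..T} \<times> {-R..R}) z *\<^sub>R g z = indicator ?A z *\<^sub>R g z"
      using g(2)[of "fst z" "snd z"] by (cases z) (fastforce simp: indicator_def)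
  qed
  finally have "integrable lborel (\<lambda>z. (indicator ?A z *\<^sub>R g z) * f z)"
    by (rule integrable_mult_bounded) (use f in auto)
  then show ?thesis by (simp add: set_integrable_def mult_ac)
qed

text \<open>Used to integrate by parts across the crest: a continuous, piecewise differentiable
  product with a test function leaves no boundary term.\<close>

lemma integral_deriv_compact_support:
  fixes f F :: "real \<Rightarrow> real"
  assumes "integrable lborel f" "finite S" "continuous_on UNIV F"
    and "\<And>x. x \<notin> S \<Longrightarrow> (F has_real_derivative f x) (at x)"
    and zero: "\<And>x. \<bar>x\<bar> > R \<Longrightarrow> F x = 0"
  shows "(LBINT x. f x) = 0"
proof -
  have "(F \<longlongrightarrow> 0) at_bot"
    by (rule tendsto_eventually)
      (auto intro!: zero exI[of _ "- \<bar>R\<bar> - 1"] simp: eventually_at_bot_linorder)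
  moreover have "(F \<longlongrightarrow> 0) at_top"
    by (rule tendsto_eventually)
      (auto intro!: zero intro: eventually_mono[OF eventually_gt_at_top[of "\<bar>R\<bar>"]])
  ultimately show ?thesis
    using integral_real_line_FTC[OF assms(1-4)] by fastforce
qed

lemma Cc_infinity_props:
  assumes "Cc_infinity \<psi>"
  obtains R where "continuous_on UNIV \<psi>" "continuous_on UNIV (deriv \<psi>)"
    "\<And>x. (\<psi> has_real_derivative deriv \<psi> x) (at x)"
    "\<And>x. \<bar>x\<bar> > R \<Longrightarrow> \<psi> x = 0" "\<And>x. \<bar>x\<bar> > R \<Longrightarrow> deriv \<psi> x = 0"
proof -
  have d: "(deriv ^^ k) \<psi> differentiable (at x)" for k x
    using assms by (auto simp: Cc_infinity_def)
  from d[of 0] d[of 1] have d': "\<psi> differentiable (at x)" "deriv \<psi> differentiable (at x)" for x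
    by simp_all
  have "bounded {x. \<psi> x \<noteq> 0}"
    using assms by (auto simp: Cc_infinity_def intro: bounded_subset compact_imp_bounded closure_subset)
  then obtain R where R: "\<And>x. \<psi> x \<noteq> 0 \<Longrightarrow> \<bar>x\<bar> \<le> R"
    by (auto simp: bounded_iff)
  then have zero: "\<psi> x = 0" if "\<bar>x\<bar> > R" for x
    using that by (meson not_less)
  \<comment> \<open>The strict inequality makes the region open, so vanishing there passes to the
    derivative.\<close>
  have "deriv \<psi> x = 0" if "\<bar>x\<bar> > R" for x
  proof (rule DERIV_imp_deriv, rule has_field_derivative_transform_within_open)
    show "((\<lambda>_. 0) has_real_derivative 0) (at x)" by simp
    show "open (- cball (0::real) R)" "x \<in> - cball 0 R" using that by auto
  qed (simp add: zero)
  then show ?thesis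
    using d' zero
    by (intro that[of R] continuous_at_imp_continuous_on)
      (auto intro: differentiable_imp_continuous_within simp: DERIV_deriv_iff_real_differentiable)
qed

text \<open>Secures uniqueness of derivatives within \<open>{0..}\<close>, including the one-sided
  one at 0: a closure of an open set has no isolated points.\<close>

lemma at_within_atLeast_neq_bot: "t \<ge> 0 \<Longrightarrow> at t within {0::real..} \<noteq> bot"
  by (simp add: trivial_limit_within islimpt_closure_open[where s = "{0<..}"])

text \<open>Along the line x = \<xi> + c t the transport operator is a total time derivative.
  Working within \<open>{0..}\<close> includes the starting time.\<close>

lemma Ck_halfplane_chain_rule:
  assumes "Ck_halfplane (Suc 0) \<phi>" "t \<ge> 0"
  shows "((\<lambda>s. \<phi> s (\<xi> + c * s)) has_vector_derivative
    partial_t \<phi> t (\<xi> + c * t) + c * partial_x \<phi> t (\<xi> + c * t)) (at t within {0..})"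
proof -
  have dt: "((\<lambda>s. \<phi> s x) has_derivative (\<lambda>h. h * partial_t \<phi> t x)) (at t within {0..})" for x
    using assms vector_derivative_works[of "\<lambda>s. \<phi> s x" "at t within {0..}"]
    by (simp add: partial_t_def has_vector_derivative_def)
  have dx: "(\<phi> t has_derivative blinfun_apply (blinfun_mult_left (partial_x \<phi> t x))) (at x within UNIV)"
    if "t \<in> {0..}" for t x
    using assms that DERIV_deriv_iff_real_differentiable[of "\<phi> t" x]
    by (simp add: partial_x_def has_field_derivative_def mult_commute_abs)
  have "continuous_on ({0..} \<times> UNIV) (\<lambda>(t, x). partial_x \<phi> t x)"
    using assms by simp
  then have "continuous_on ({0..} \<times> UNIV) (\<lambda>(t, x). blinfun_mult_left (partial_x \<phi> t x))"
    unfolding split_beta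
    by (intro bounded_linear.continuous_on[OF bounded_linear_blinfun_mult_left])
  then have "continuous (at (t, \<xi> + c * t) within {0..} \<times> UNIV)
      (\<lambda>(t, x). blinfun_mult_left (partial_x \<phi> t x))"
    using assms(2) by (simp add: continuous_on_eq_continuous_within)
  \<comment> \<open>Continuity of \<open>partial_x\<close> upgrades the separate partial derivatives
    to a total derivative on the half-plane.\<close>
  from has_derivative_partialsI[OF dt dx this]
  have "((\<lambda>(t, x). \<phi> t x) has_derivative
      (\<lambda>(h, k). h * partial_t \<phi> t (\<xi> + c * t) + k * partial_x \<phi> t (\<xi> + c * t)))
      (at (t, \<xi> + c * t) within {0..} \<times> UNIV)"
    by simp
  then have "((\<lambda>s. case (s, \<xi> + c * s) of (t, x) \<Rightarrow> \<phi> t x) has_derivative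
      (\<lambda>h. (\<lambda>(h, k). h * partial_t \<phi> t (\<xi> + c * t) + k * partial_x \<phi> t (\<xi> + c * t)) (h, c * h)))
      (at t within {0..})"
  proof (rule has_derivative_in_compose[rotated, OF has_derivative_subset])
    show "((\<lambda>s. (s, \<xi> + c * s)) has_derivative (\<lambda>h. (h, c * h))) (at t within {0..})"
      by (auto intro!: derivative_eq_intros)
  qed auto
  then show ?thesis
    by (simp add: has_vector_derivative_def algebra_simps)
qed

lemma test_function_props:
  assumes "Cc_infinity_spacetime T \<phi>" "T > 0"
  obtains R where
    "continuous_on ({0..} \<times> UNIV) (\<lambda>(t, x). \<phi> t x)"
    "continuous_on ({0..} \<times> UNIV) (\<lambda>(t, x). partial_t \<phi> t x)"
    "continuous_on ({0..} \<times> UNIV) (\<lambda>(t, x). partial_x \<phi> t x)"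
    "\<And>t x. t \<ge> 0 \<Longrightarrow> (\<phi> t has_real_derivative partial_x \<phi> t x) (at x)"
    "\<And>t x. t \<ge> 0 \<Longrightarrow> \<bar>x\<bar> > R \<Longrightarrow> \<phi> t x = 0"
    "\<And>t x. t \<ge> 0 \<Longrightarrow> \<bar>x\<bar> > R \<Longrightarrow> partial_t \<phi> t x = 0"
    "\<And>t x. t \<ge> 0 \<Longrightarrow> \<bar>x\<bar> > R \<Longrightarrow> partial_x \<phi> t x = 0"
    "\<And>x. \<phi> T x = 0"
proof -
  let ?S = "{(t, x). 0 \<le> t \<and> \<phi> t x \<noteq> 0}"
  have C1: "Ck_halfplane (Suc 0) \<phi>" and "compact (closure ?S)" and sub: "closure ?S \<subseteq> {0..<T} \<times> UNIV"
    using assms by (auto simp: Cc_infinity_spacetime_def)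
  then have "bounded ?S" by (meson bounded_subset compact_imp_bounded closure_subset)
  then obtain R where R: "\<And>z. z \<in> ?S \<Longrightarrow> norm z \<le> R" by (auto simp: bounded_iff)
  have zero: "\<phi> t x = 0" if "t \<ge> 0" "\<bar>x\<bar> > R" for t x
  proof (rule ccontr)
    assume "\<phi> t x \<noteq> 0"
    then have "norm (t, x) \<le> R" using that by (intro R) auto
    with norm_snd_le[of x t] that show False by simp
  qed
  have deriv: "(\<phi> t has_real_derivative partial_x \<phi> t x) (at x)" if "t \<ge> 0" for t x
    using C1 that by (simp add: partial_x_def DERIV_deriv_iff_real_differentiable)
  have zero_t: "partial_t \<phi> t x = 0" if "t \<ge> 0" "\<bar>x\<bar> > R" for t x
    unfolding partial_t_def
  proof (rule vector_derivative_within[OF at_within_atLeast_neq_bot[OF that(1)]])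
    show "((\<lambda>s. \<phi> s x) has_vector_derivative 0) (at t within {0..})"
      by (rule has_vector_derivative_transform[where f = "\<lambda>_. 0"]) (use that in \<open>auto simp: zero\<close>)
  qed
  have zero_x: "partial_x \<phi> t x = 0" if "t \<ge> 0" "\<bar>x\<bar> > R" for t x
    unfolding partial_x_def
  proof (rule DERIV_imp_deriv, rule has_field_derivative_transform_within_open)
    show "((\<lambda>_. 0) has_real_derivative 0) (at x)" by simp
    show "open (- cball (0::real) R)" "x \<in> - cball 0 R" using that by auto
  qed (use that in \<open>simp add: zero\<close>)
  \<comment> \<open>The support stays strictly before time \<open>T\<close>; this later removes the
    upper endpoint in the time integral.\<close>
  have "(T, x) \<notin> closure ?S" for x using sub by auto
  then have "(T, x) \<notin> ?S" for x by (meson closure_subset subsetD)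
  then have "\<phi> T x = 0" for x using assms(2) by simp
  then show ?thesis
    using C1 deriv zero zero_t zero_x by (intro that[of R]) auto
qed

section \<open>Integrability and weak derivative of a peaked profile\<close>

lemma integrable_exp_minus_abs_power:
  "m \<ge> 1 \<Longrightarrow> integrable lborel (\<lambda>x::real. exp (- \<bar>x - s\<bar>) ^ m)"
  using integrable_mult_bounded[OF integrable_exp_minus_abs[of s],
      of "\<lambda>x. exp (- \<bar>x - s\<bar>) ^ (m - 1)" 1]
  by (cases m) (auto simp: exp_minus_abs_power_le)

text \<open>The profile is continuous across its crest, so its weak derivative is the pointwise one
  with no point mass: the product with a test function integrates its derivative to zero.\<close>

lemma has_weak_derivative_peakon:
  "has_weak_derivative (\<lambda>x. a * exp (- \<bar>x - s\<bar>)) (\<lambda>x. - side (x - s) * (a * exp (- \<bar>x - s\<bar>)))"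
  (is "has_weak_derivative ?u ?v")
proof -
  have int_u: "integrable lborel ?u"
    by (intro integrable_mult_right integrable_exp_minus_abs)
  have "integrable lborel (\<lambda>x. ?u x * - side (x - s))"
    by (rule integrable_mult_bounded[OF int_u, where B = 1]) auto
  then have int_v: "integrable lborel ?v"
    by (simp add: mult_ac)
  have "(LBINT x. ?u x * deriv \<psi> x) = - (LBINT x. ?v x * \<psi> x)" if test: "Cc_infinity \<psi>" for \<psi>
  proof -
    obtain R where \<psi>: "continuous_on UNIV \<psi>" "continuous_on UNIV (deriv \<psi>)"
      "\<And>x. (\<psi> has_real_derivative deriv \<psi> x) (at x)"
      "\<And>x. \<bar>x\<bar> > R \<Longrightarrow> \<psi> x = 0" "\<And>x. \<bar>x\<bar> > R \<Longrightarrow> deriv \<psi> x = 0"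
      using Cc_infinity_props[OF test] by blast
    have 1: "integrable lborel (\<lambda>x. ?u x * deriv \<psi> x)" and 2: "integrable lborel (\<lambda>x. ?v x * \<psi> x)"
      by (intro integrable_mult_compact_support[OF _ _ \<psi>(2,5), where B = "\<bar>a\<bar>"]
          integrable_mult_compact_support[OF _ _ \<psi>(1,4), where B = "\<bar>a\<bar>"];
        simp add: abs_mult mult_left_le)+
    have "(LBINT x. ?u x * deriv \<psi> x + ?v x * \<psi> x) = 0"
    proof (rule integral_deriv_compact_support[where S = "{s}" and F = "\<lambda>x. ?u x * \<psi> x"])
      show "((\<lambda>x. ?u x * \<psi> x) has_real_derivative ?u x * deriv \<psi> x + ?v x * \<psi> x) (at x)" if "x \<notin> {s}" for x
        using DERIV_exp_abs_power[of x s 1] that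
        by (auto intro!: DERIV_cong[OF DERIV_mult[OF DERIV_cmult \<psi>(3)]])
    qed (use \<psi> 1 2 in \<open>auto intro!: continuous_intros\<close>)
    then show ?thesis using 1 2 by simp
  qed
  then show ?thesis
    using int_u int_v
    by (simp add: has_weak_derivative_def integrable_imp_locally_integrable)
qed

section \<open>The peaked function\<close>

text \<open>An odd power of the derivative retains one factor \<open>- side y\<close>, so every
  monomial becomes the same multiple of \<open>w ^ (2 * n)\<close>. The coefficients are those of
  \<open>peakon_sum\<close> without its leading term 1.\<close>

lemma nonlin_S_side:
  assumes "n \<ge> 1"
  shows "nonlin_S n w (- side y * w) = - (1 - peakon_sum n) * (side y * w ^ (2 * n))"
proof -
  have "nonlin_S n w (- side y * w) = (\<Sum>k = 1..n - 1.
      (-1) ^ k / (2 * real k + 1) * real ((n - 1) choose k) * (side y * w ^ (2 * n)))"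
    unfolding nonlin_S_def
  proof (rule sum.cong[OF refl])
    fix k assume k: "k \<in> {1..n - 1}"
    \<comment> \<open>The range \<open>k \<le> n - 1\<close> keeps the natural-number subtraction
      from truncating.\<close>
    then have "2 * n = (2 * n - 2 * k - 1) + (2 * k + 1)" using assms by auto
    then have "w ^ (2 * n) = w ^ (2 * n - 2 * k - 1) * w ^ (2 * k + 1)"
      by (metis power_add)
    moreover have "(- side y) ^ (2 * k + 1) = - side y"
      by (simp add: side_def)
    then have "(- side y * w) ^ (2 * k + 1) = - side y * w ^ (2 * k + 1)"
      by (simp only: power_mult_distrib)
    ultimately show "(-1) ^ (k + 1) / (2 * real k + 1) * real ((n - 1) choose k) *
        w ^ (2 * n - 2 * k - 1) * (- side y * w) ^ (2 * k + 1) =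
      (-1) ^ k / (2 * real k + 1) * real ((n - 1) choose k) * (side y * w ^ (2 * n))"
      by (simp only: ) simp
  qed
  also have "\<dots> = (\<Sum>k = 1..n - 1. (-1) ^ k / (2 * real k + 1) * real ((n - 1) choose k))
      * (side y * w ^ (2 * n))"
    by (rule sum_distrib_right[symmetric])
  also have "(\<Sum>k = 1..n - 1. (-1) ^ k / (2 * real k + 1) * real ((n - 1) choose k)) = - (1 - peakon_sum n)"
    unfolding peakon_sum_def by (simp add: sum.atLeast_Suc_atMost)
  finally show ?thesis .
qed

text \<open>Even powers lose the sign, and the leading coefficient 1 cancels the -1 in
  \<open>peakon_sum_shifted\<close>.\<close>

lemma nonlin_F_side:
  assumes "n \<ge> 1"
  shows "nonlin_F n w (- side y * w) = (2 * real n * peakon_sum n - 1 / (2 * real n)) * w ^ (2 * n)"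
proof -
  have "nonlin_F n w (- side y * w) = w ^ (2 * n) + (\<Sum>k = 1..n.
      (-1) ^ (k - 1) * (2 * real n - 2 * real k + 1) / (2 * real n * (2 * real k - 1))
        * real (n choose k) * w ^ (2 * n))"
    unfolding nonlin_F_def
  proof (rule arg_cong[where f = "(+) _"], rule sum.cong[OF refl])
    fix k assume k: "k \<in> {1..n}"
    then have "2 * n = (2 * n - 2 * k) + 2 * k" by auto
    then have "w ^ (2 * n) = w ^ (2 * n - 2 * k) * w ^ (2 * k)"
      by (metis power_add)
    moreover have "(- side y * w) ^ (2 * k) = w ^ (2 * k)"
      using side_power_even[of y k] by (simp add: power_mult_distrib)
    ultimately show "(-1) ^ (k - 1) * (2 * real n - 2 * real k + 1) / (2 * real n * (2 * real k - 1))
        * real (n choose k) * w ^ (2 * n - 2 * k) * (- side y * w) ^ (2 * k) =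
      (-1) ^ (k - 1) * (2 * real n - 2 * real k + 1) / (2 * real n * (2 * real k - 1))
        * real (n choose k) * w ^ (2 * n)"
      by (simp only: mult.assoc)
  qed
  also have "\<dots> = (2 * real n * peakon_sum n - 1 / (2 * real n)) * w ^ (2 * n)"
    unfolding sum_distrib_right[symmetric] peakon_sum_shifted[OF assms]
    by (simp add: algebra_simps)
  finally show ?thesis .
qed

lemma convolution_cmult: "convolution f (\<lambda>y. c * g y) x = c * convolution f g x"
  by (simp add: convolution_def mult.left_commute[of _ c])

text \<open>The constant \<open>\<kappa>\<close> is the common amplitude of all terms not of
  transport type. With q = \<open>\<kappa> * (m * e ^ m - e)\<close>, the coefficient of \<phi>_x is
  c u + q and that of \<phi> is the derivative of q off the crest.\<close>

lemma weak_integrand_peakon: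
  fixes n :: nat and a c :: real
  defines "u \<equiv> \<lambda>t x. a * exp (- \<bar>x - c * t\<bar>)"
    and "v \<equiv> \<lambda>t x. - side (x - c * t) * (a * exp (- \<bar>x - c * t\<bar>))"
    and "m \<equiv> 2 * n"
  defines "\<kappa> \<equiv> (1 - peakon_sum n) * a ^ m / (real m ^ 2 - 1)"
  assumes n: "n \<ge> 1" and c: "c = peakon_sum n * a ^ (2 * n - 1)"
  shows "weak_integrand n u v \<phi> t x = u t x * partial_t \<phi> t x
    + (c * u t x + \<kappa> * (real m * exp (- \<bar>x - c * t\<bar>) ^ m - exp (- \<bar>x - c * t\<bar>))) * partial_x \<phi> t x
    + - side (x - c * t) * (\<kappa> * (real m ^ 2 * exp (- \<bar>x - c * t\<bar>) ^ m - exp (- \<bar>x - c * t\<bar>))) * \<phi> t x"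
proof -
  define e where "e = exp (- \<bar>x - c * t\<bar>)"
  define s where "s = side (x - c * t)"
  let ?D = "real m ^ 2 - 1" and ?I = "peakon_sum n"
  have m: "m \<ge> 2" "real m = 2 * real n" using n by (auto simp: m_def)
  have "1 < real m ^ 2" using m(1) by (intro one_less_power) auto
  then have D: "?D \<noteq> 0" and m0: "real m \<noteq> 0" using m by auto
  have "a ^ m = a ^ (2 * n - 1) * a"
    using n by (simp add: m_def flip: power_Suc2)
  \<comment> \<open>The speed law is used exactly here: it trades c u for a multiple of
    \<open>a ^ m * e\<close>, the scale of the nonlinear terms.\<close>
  then have ca: "c * a = ?I * a ^ m" by (simp add: c)
  have F: "nonlin_F n (u t y) (v t y) = (real m * ?I - 1 / real m) * a ^ m * exp (- \<bar>y - c * t\<bar>) ^ m" for y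
    unfolding u_def v_def nonlin_F_side[OF n] by (simp add: m_def power_mult_distrib)
  have S: "nonlin_S n (u t y) (v t y) =
      - (1 - ?I) * a ^ m * (side (y - c * t) * exp (- \<bar>y - c * t\<bar>) ^ m)" for y
    unfolding u_def v_def nonlin_S_side[OF n] by (simp add: m_def power_mult_distrib)
  \<comment> \<open>Coefficients of \<phi>_x: both sides have \<open>e\<close> with factor
    \<open>(m^2 * ?I - 1) * a ^ m / ?D\<close> and \<open>e ^ m\<close> with factor
    \<open>m * \<kappa>\<close>.\<close>
  have G: "1 / real m * u t x ^ m + (real m * ?I - 1 / real m) * a ^ m * ((real m * e - e ^ m) / ?D)
      = c * u t x + \<kappa> * (real m * e ^ m - e)"
  proof -
    have "c * u t x = ?I * a ^ m * e" by (simp add: u_def e_def flip: ca)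
    moreover have "u t x ^ m = a ^ m * e ^ m" by (simp add: u_def e_def power_mult_distrib)
    ultimately show ?thesis
      unfolding \<kappa>_def using D m0 by (simp add: divide_simps) (simp add: algebra_simps power2_eq_square)
  qed
  \<comment> \<open>Coefficients of \<phi>: subtracting p * S from S turns the factor of
    \<open>e ^ m\<close> from 1 into \<open>1 + 1 / ?D = m^2 / ?D\<close>.\<close>
  have H: "- (1 - ?I) * a ^ m * (s * e ^ m) - - (1 - ?I) * a ^ m * (s * ((e - e ^ m) / ?D))
      = - s * (\<kappa> * (real m ^ 2 * e ^ m - e))"
    unfolding \<kappa>_def using D by (simp add: divide_simps) (simp add: algebra_simps power2_eq_square)
  show ?thesis
    unfolding weak_integrand_def F S convolution_cmult peak_kernel_exp_power[OF m(1)]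
      peak_kernel_side_exp_power[OF m(1)]
    unfolding m(2)[symmetric] e_def[symmetric] s_def[symmetric] m_def[symmetric]
    unfolding G[symmetric] H[symmetric]
    by (simp only: distrib_right left_diff_distrib)
qed

section \<open>Membership in the function spaces and existence of the convolutions\<close>

lemma Linf_loc_W1_loc_peakon:
  assumes "q \<ge> 1"
  shows "Linf_loc_W1_loc q T (\<lambda>t x. a * exp (- \<bar>x - c * t\<bar>))
    (\<lambda>t x. - side (x - c * t) * (a * exp (- \<bar>x - c * t\<bar>)))"
proof -
  let ?A = "{0..<T} \<times> (UNIV :: real set)"
  have A: "?A \<in> sets (borel :: (real \<times> real) measure)"
    by (intro borel_Times) auto
  have "(\<lambda>(t, x). a * exp (- \<bar>x - c * t\<bar>)) \<in> borel_measurable (borel :: (real \<times> real) measure)"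
    "(\<lambda>(t, x). - side (x - c * t) * (a * exp (- \<bar>x - c * t\<bar>)))
      \<in> borel_measurable (borel :: (real \<times> real) measure)"
    unfolding split_beta borel_prod[symmetric] by measurable
  then have "set_borel_measurable lborel ?A (\<lambda>(t, x). a * exp (- \<bar>x - c * t\<bar>))"
    "set_borel_measurable lborel ?A (\<lambda>(t, x). - side (x - c * t) * (a * exp (- \<bar>x - c * t\<bar>)))"
    using A unfolding set_borel_measurable_def
    by (auto intro!: borel_measurable_scaleR borel_measurable_indicator)
  moreover have abs_v: "\<bar>- side y * z\<bar> = \<bar>z\<bar>" for y z
    by (simp add: abs_mult)
  have "\<exists>C. AE t in lborel. t \<in> K \<longrightarrow>
           set_integrable lborel L (\<lambda>x. \<bar>a * exp (- \<bar>x - c * t\<bar>)\<bar> ^ q) \<and>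
           set_integrable lborel L (\<lambda>x. \<bar>- side (x - c * t) * (a * exp (- \<bar>x - c * t\<bar>))\<bar> ^ q) \<and>
           (LBINT x:L. \<bar>a * exp (- \<bar>x - c * t\<bar>)\<bar> ^ q)
             + (LBINT x:L. \<bar>- side (x - c * t) * (a * exp (- \<bar>x - c * t\<bar>))\<bar> ^ q) \<le> C"
    if "compact L" for K L
  proof -
    have int: "set_integrable lborel L (\<lambda>x. \<bar>a * exp (- \<bar>x - c * t\<bar>)\<bar> ^ q)" for t
      unfolding set_integrable_def
      by (intro borel_integrable_compact that continuous_intros)
    have "set_integrable lborel L (\<lambda>x. \<bar>a\<bar> ^ q)"
      unfolding set_integrable_def
      by (intro borel_integrable_compact that continuous_intros)
    \<comment> \<open>The pointwise bound by \<open>\<bar>a\<bar>\<close> does not see the crest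
      position, hence the constant is uniform in time.\<close>
    then have "(LBINT x:L. \<bar>a * exp (- \<bar>x - c * t\<bar>)\<bar> ^ q) \<le> (LBINT x:L. \<bar>a\<bar> ^ q)" for t
      by (intro set_integral_mono int power_mono) (auto simp: abs_mult mult_left_le)
    from add_mono[OF this this] int show ?thesis
      unfolding abs_v by (intro exI[of _ "(LBINT x:L. \<bar>a\<bar> ^ q) + (LBINT x:L. \<bar>a\<bar> ^ q)"] AE_I2) blast
  qed
  ultimately show ?thesis
    unfolding Linf_loc_W1_loc_def by (intro conjI allI impI AE_I2 has_weak_derivative_peakon) auto
qed

lemma sobolev_W1_peakon:
  assumes "q \<ge> 1"
  shows "sobolev_W1 q (\<lambda>x. a * exp (- \<bar>x\<bar>))"
proof -
  have "integrable lborel (\<lambda>x. \<bar>a * exp (- \<bar>x\<bar>)\<bar> ^ q)"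
    using integrable_exp_minus_abs_power[OF assms, of 0] by (simp add: abs_mult power_mult_distrib)
  then show ?thesis
    using has_weak_derivative_peakon[of a 0] unfolding sobolev_W1_def
    by (intro exI[of _ "\<lambda>x. - side x * (a * exp (- \<bar>x\<bar>))"]) (simp add: abs_mult)
qed

text \<open>Both nonlinearities are bounded Borel functions of \<open>y\<close>, and the kernel is
  integrable.\<close>

lemma convolution_exists_peakon:
  assumes "n \<ge> 1"
  shows "convolution_exists peak_kernel (\<lambda>y. nonlin_F n (a * exp (- \<bar>y - s\<bar>)) (- side (y - s) * (a * exp (- \<bar>y - s\<bar>))))"
    "convolution_exists peak_kernel (\<lambda>y. nonlin_S n (a * exp (- \<bar>y - s\<bar>)) (- side (y - s) * (a * exp (- \<bar>y - s\<bar>))))"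
proof -
  have "\<bar>(a * exp (- \<bar>y - s\<bar>)) ^ k\<bar> \<le> \<bar>a\<bar> ^ k" for y k
    unfolding power_abs by (intro power_mono) (auto simp: abs_mult mult_left_le)
  then have *: "\<bar>A * (a * exp (- \<bar>y - s\<bar>)) ^ k\<bar> \<le> \<bar>A\<bar> * \<bar>a\<bar> ^ k"
    "\<bar>A * (side (y - s) * (a * exp (- \<bar>y - s\<bar>)) ^ k)\<bar> \<le> \<bar>A\<bar> * \<bar>a\<bar> ^ k" for A y k
    unfolding abs_mult[of A] abs_mult[of "side _"] by (auto intro: mult_left_mono)
  show "convolution_exists peak_kernel (\<lambda>y. nonlin_F n (a * exp (- \<bar>y - s\<bar>)) (- side (y - s) * (a * exp (- \<bar>y - s\<bar>))))"
    unfolding convolution_exists_def nonlin_F_side[OF assms]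
    by (intro allI integrable_peak_kernel_mult[OF _ *(1)]) simp
  show "convolution_exists peak_kernel (\<lambda>y. nonlin_S n (a * exp (- \<bar>y - s\<bar>)) (- side (y - s) * (a * exp (- \<bar>y - s\<bar>))))"
    unfolding convolution_exists_def nonlin_S_side[OF assms]
    by (intro allI integrable_peak_kernel_mult[OF _ *(2)]) simp
qed

section \<open>Evaluation of the space-time integral\<close>

text \<open>Translating space by c t freezes the exponential weight. Fubini then puts the time
  integral inside, where the fundamental theorem along each characteristic leaves only the value at
  time 0.\<close>

lemma integral_transport:
  assumes \<phi>: "Cc_infinity_spacetime T \<phi>" and T: "T > 0"
  shows "(LBINT t:{0..<T}. (LBINT x. a * exp (- \<bar>x - c * t\<bar>) * (partial_t \<phi> t x + c * partial_x \<phi> t x)))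
    = - (LBINT x. a * exp (- \<bar>x\<bar>) * \<phi> 0 x)"
proof -
  obtain R where cont: "continuous_on ({0..} \<times> UNIV) (\<lambda>(t, x). partial_t \<phi> t x)"
      "continuous_on ({0..} \<times> UNIV) (\<lambda>(t, x). partial_x \<phi> t x)"
    and zero: "\<And>t x. t \<ge> 0 \<Longrightarrow> \<bar>x\<bar> > R \<Longrightarrow> partial_t \<phi> t x = 0"
      "\<And>t x. t \<ge> 0 \<Longrightarrow> \<bar>x\<bar> > R \<Longrightarrow> partial_x \<phi> t x = 0"
    and zero_T: "\<And>x. \<phi> T x = 0"
    using test_function_props[OF assms] by metis
  define \<psi> where "\<psi> t \<xi> = partial_t \<phi> t (\<xi> + c * t) + c * partial_x \<phi> t (\<xi> + c * t)" for t \<xi>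
  have cont\<psi>: "continuous_on ({0..} \<times> UNIV) (\<lambda>z. \<psi> (fst z) (snd z))"
  proof -
    have "continuous_on ({0..} \<times> UNIV) (\<lambda>z. case (fst z, snd z + c * fst z) of (t, x) \<Rightarrow> f t x)"
      if "continuous_on ({0..} \<times> UNIV) (\<lambda>(t, x). f t x)" for f :: "real \<Rightarrow> real \<Rightarrow> real"
      by (rule continuous_on_compose2[OF that]) (auto intro!: continuous_intros)
    from this[OF cont(1)] this[OF cont(2)] show ?thesis
      unfolding \<psi>_def prod.case by (intro continuous_intros)
  qed
  \<comment> \<open>Up to time \<open>T\<close> the moving frame shifts the support by at most
    \<open>\<bar>c\<bar> * T\<close>, hence the enlarged radius.\<close>
  have zero\<psi>: "\<psi> t \<xi> = 0" if "0 \<le> t" "t < T" "\<bar>\<xi>\<bar> > R + \<bar>c\<bar> * T" for t \<xi>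
  proof -
    have "\<bar>c * t\<bar> \<le> \<bar>c\<bar> * T" using that by (simp add: abs_mult mult_left_mono)
    then have "\<bar>\<xi> + c * t\<bar> > R" using that by linarith
    then show ?thesis using zero that by (simp add: \<psi>_def)
  qed
  \<comment> \<open>Placing the time restriction in the integrand puts both iterated integrals over
    the full line, as Fubini requires.\<close>
  define h where "h t \<xi> = indicator {0..<T} t * (a * exp (- \<bar>\<xi>\<bar>) * \<psi> t \<xi>)" for t \<xi>
  have "set_integrable lborel ({0..<T} \<times> UNIV) (\<lambda>z. (a * exp (- \<bar>snd z\<bar>)) * \<psi> (fst z) (snd z))"
  proof (rule set_integrable_mult_compact_support[where B = "\<bar>a\<bar>"])
    show "(\<lambda>z. a * exp (- \<bar>snd z\<bar>)) \<in> borel_measurable (borel :: (real \<times> real) measure)"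
      unfolding borel_prod[symmetric] by measurable
  qed (use cont\<psi> zero\<psi> in \<open>auto simp: abs_mult mult_left_le\<close>)
  then have int: "integrable (lborel \<Otimes>\<^sub>M lborel) (\<lambda>(t, \<xi>). h t \<xi>)"
    by (simp add: lborel_prod set_integrable_def h_def case_prod_unfold indicator_times)
  have "(LBINT t:{0..<T}. (LBINT x. a * exp (- \<bar>x - c * t\<bar>) * (partial_t \<phi> t x + c * partial_x \<phi> t x)))
      = (LBINT t. LBINT \<xi>. h t \<xi>)"
  proof -
    have "(LBINT x. a * exp (- \<bar>x - c * t\<bar>) * (partial_t \<phi> t x + c * partial_x \<phi> t x)) =
        (LBINT \<xi>. a * exp (- \<bar>\<xi>\<bar>) * \<psi> t \<xi>)" for t
      by (subst lborel_integral_real_affine[where c = 1 and t = "c * t"])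
        (simp_all add: \<psi>_def add.commute)
    then show ?thesis
      by (simp add: set_lebesgue_integral_def h_def)
  qed
  also have "\<dots> = (LBINT \<xi>. LBINT t. h t \<xi>)"
    by (rule lborel_pair.Fubini_integral[OF int, symmetric])
  also have "(\<lambda>\<xi>. LBINT t. h t \<xi>) = (\<lambda>\<xi>. - (a * exp (- \<bar>\<xi>\<bar>) * \<phi> 0 \<xi>))"
  proof
    fix \<xi>
    have C1: "Ck_halfplane (Suc 0) \<phi>" using \<phi> by (auto simp: Cc_infinity_spacetime_def)
    have "((\<lambda>t. \<psi> t \<xi>) has_integral \<phi> T (\<xi> + c * T) - \<phi> 0 (\<xi> + c * 0)) {0..T}"
      unfolding \<psi>_def using T
      by (intro fundamental_theorem_of_calculus has_vector_derivative_within_subset[OF Ck_halfplane_chain_rule[OF C1]])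
        auto
    \<comment> \<open>The endpoint \<open>T\<close> is a null set for the integral, and
      \<open>\<phi>\<close> vanishes there.\<close>
    then have "((\<lambda>t. \<psi> t \<xi>) has_integral - \<phi> 0 \<xi>) {0..<T}"
      using T by (subst has_integral_spike_set_eq[of _ "{0..T}"])
        (auto simp: zero_T intro: negligible_subset[of "{T}"])
    moreover have "set_integrable lborel {0..<T} (\<lambda>t. \<psi> t \<xi>)"
    proof (rule set_integrable_subset)
      show "set_integrable lborel {0..T} (\<lambda>t. \<psi> t \<xi>)"
        unfolding set_integrable_def
        by (intro borel_integrable_compact continuous_on_compose2[OF cont\<psi>, of _ "\<lambda>t. (t, \<xi>)", simplified])
          (auto intro!: continuous_intros)
    qed auto
    ultimately have "(LBINT t:{0..<T}. \<psi> t \<xi>) = - \<phi> 0 \<xi>"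
      by (metis set_borel_integral_eq_integral(2) integral_unique)
    then show "(LBINT t. h t \<xi>) = - (a * exp (- \<bar>\<xi>\<bar>) * \<phi> 0 \<xi>)"
      by (simp add: h_def set_lebesgue_integral_def mult.left_commute[of "indicator _ _"])
  qed
  finally show ?thesis by simp
qed

text \<open>At fixed time the terms with \<open>\<kappa>\<close> form the x-derivative of a
  continuous, compactly supported product, so they integrate to zero and only transport
  remains.\<close>

lemma integral_slice:
  fixes m :: nat
  assumes \<phi>: "Cc_infinity_spacetime T \<phi>" and T: "T > 0" "t \<ge> 0"
  shows "(LBINT x. a * exp (- \<bar>x - s\<bar>) * partial_t \<phi> t x
      + (c * (a * exp (- \<bar>x - s\<bar>)) + \<kappa> * (real m * exp (- \<bar>x - s\<bar>) ^ m - exp (- \<bar>x - s\<bar>))) * partial_x \<phi> t x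
      + - side (x - s) * (\<kappa> * (real m ^ 2 * exp (- \<bar>x - s\<bar>) ^ m - exp (- \<bar>x - s\<bar>))) * \<phi> t x)
    = (LBINT x. a * exp (- \<bar>x - s\<bar>) * (partial_t \<phi> t x + c * partial_x \<phi> t x))"
proof -
  obtain R where cont: "continuous_on ({0..} \<times> UNIV) (\<lambda>(t, x). \<phi> t x)"
      "continuous_on ({0..} \<times> UNIV) (\<lambda>(t, x). partial_t \<phi> t x)"
      "continuous_on ({0..} \<times> UNIV) (\<lambda>(t, x). partial_x \<phi> t x)"
    and deriv: "\<And>t x. t \<ge> 0 \<Longrightarrow> (\<phi> t has_real_derivative partial_x \<phi> t x) (at x)"
    and zero: "\<And>t x. t \<ge> 0 \<Longrightarrow> \<bar>x\<bar> > R \<Longrightarrow> \<phi> t x = 0"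
      "\<And>t x. t \<ge> 0 \<Longrightarrow> \<bar>x\<bar> > R \<Longrightarrow> partial_t \<phi> t x = 0"
      "\<And>t x. t \<ge> 0 \<Longrightarrow> \<bar>x\<bar> > R \<Longrightarrow> partial_x \<phi> t x = 0"
    using test_function_props[OF \<phi> T(1)] by metis
  have slice: "continuous_on UNIV (f t)" if "continuous_on ({0..} \<times> UNIV) (\<lambda>(t, x). f t x)"
    for f :: "real \<Rightarrow> real \<Rightarrow> real"
  proof -
    have "continuous_on UNIV (\<lambda>x. case (t, x) of (t, x) \<Rightarrow> f t x)"
      by (rule continuous_on_compose2[OF that]) (use T(2) in \<open>auto intro!: continuous_intros\<close>)
    then show ?thesis by simp
  qed
  let ?e = "\<lambda>x. exp (- \<bar>x - s\<bar>)"
  let ?q = "\<lambda>x. \<kappa> * (real m * ?e x ^ m - ?e x)"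
  let ?q' = "\<lambda>x. - side (x - s) * (\<kappa> * (real m ^ 2 * ?e x ^ m - ?e x))"
  \<comment> \<open>One estimate covers both factors: \<open>k = m\<close> for \<open>?q\<close> and
    \<open>k = m^2\<close> for \<open>?q'\<close>.\<close>
  have bound: "\<bar>\<kappa> * (k * ?e x ^ m - ?e x)\<bar> \<le> \<bar>\<kappa>\<bar> * (k + 1)" if "k \<ge> 0" for k x
  proof -
    have "0 \<le> k * ?e x ^ m" "k * ?e x ^ m \<le> k" "0 \<le> ?e x" "?e x \<le> 1"
      using that by (simp_all add: mult_left_le exp_minus_abs_power_le)
    then have "\<bar>k * ?e x ^ m - ?e x\<bar> \<le> k + 1" using that by linarith
    then show ?thesis by (simp add: abs_mult mult_left_mono)
  qed
  have 1: "integrable lborel (\<lambda>x. a * ?e x * (partial_t \<phi> t x + c * partial_x \<phi> t x))"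
    using slice[OF cont(2)] slice[OF cont(3)] zero T(2)
    by (intro integrable_mult_compact_support[where B = "\<bar>a\<bar>" and R = R])
      (auto simp: abs_mult mult_left_le intro!: continuous_intros)
  have 2: "integrable lborel (\<lambda>x. ?q x * partial_x \<phi> t x)"
    by (rule integrable_mult_compact_support[OF _ bound slice[OF cont(3)] zero(3)]) (use T(2) in auto)
  have 3: "integrable lborel (\<lambda>x. ?q' x * \<phi> t x)"
    using bound[of "real m ^ 2"]
    by (intro integrable_mult_compact_support[OF _ _ slice[OF cont(1)] zero(1)[OF T(2)],
          where B = "\<bar>\<kappa>\<bar> * (real m ^ 2 + 1)"]) (auto simp: abs_mult)
  have "(LBINT x. ?q x * partial_x \<phi> t x + ?q' x * \<phi> t x) = 0"
  proof (rule integral_deriv_compact_support[where S = "{s}" and F = "\<lambda>x. ?q x * \<phi> t x" and R = R])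
    show "((\<lambda>x. ?q x * \<phi> t x) has_real_derivative ?q x * partial_x \<phi> t x + ?q' x * \<phi> t x) (at x)"
      if "x \<notin> {s}" for x
      by (rule DERIV_cong[OF DERIV_mult[OF DERIV_cmult[OF DERIV_diff[OF DERIV_cmult[OF
              DERIV_exp_abs_power[of x s m]] DERIV_exp_abs_power[of x s 1, unfolded power_one_right]]]
              deriv[OF T(2)]]])
        (use that in \<open>simp_all add: algebra_simps power2_eq_square\<close>)
  qed (use slice[OF cont(1)] zero T(2) 2 3 in \<open>auto intro!: continuous_intros\<close>)
  with 1 2 3 have "(LBINT x. a * ?e x * (partial_t \<phi> t x + c * partial_x \<phi> t x)
      + (?q x * partial_x \<phi> t x + ?q' x * \<phi> t x)) =
      (LBINT x. a * ?e x * (partial_t \<phi> t x + c * partial_x \<phi> t x))"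
    by (subst Bochner_Integration.integral_add) auto
  moreover have eq: "a * ?e x * (partial_t \<phi> t x + c * partial_x \<phi> t x)
      + (?q x * partial_x \<phi> t x + ?q' x * \<phi> t x) =
      a * ?e x * partial_t \<phi> t x + (c * (a * ?e x) + ?q x) * partial_x \<phi> t x + ?q' x * \<phi> t x" for x
    by (simp add: algebra_simps)
  ultimately show ?thesis by (simp only: eq)
qed

text \<open>The integrand is grouped by \<phi>_t, \<phi>_x and \<phi>. Each group is a bounded Borel
  coefficient times a continuous function with bounded spatial support.\<close>

lemma set_integrable_peakon_integrand:
  fixes m :: nat
  assumes \<phi>: "Cc_infinity_spacetime T \<phi>" and T: "T > 0"
  shows "set_integrable lborel ({0..<T} \<times> UNIV) (\<lambda>(t, x). a * exp (- \<bar>x - c * t\<bar>) * partial_t \<phi> t x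
      + (c * (a * exp (- \<bar>x - c * t\<bar>)) + \<kappa> * (real m * exp (- \<bar>x - c * t\<bar>) ^ m - exp (- \<bar>x - c * t\<bar>)))
          * partial_x \<phi> t x
      + - side (x - c * t) * (\<kappa> * (real m ^ 2 * exp (- \<bar>x - c * t\<bar>) ^ m - exp (- \<bar>x - c * t\<bar>))) * \<phi> t x)"
proof -
  obtain R where cont: "continuous_on ({0..} \<times> UNIV) (\<lambda>(t, x). \<phi> t x)"
      "continuous_on ({0..} \<times> UNIV) (\<lambda>(t, x). partial_t \<phi> t x)"
      "continuous_on ({0..} \<times> UNIV) (\<lambda>(t, x). partial_x \<phi> t x)"
    and zero: "\<And>t x. t \<ge> 0 \<Longrightarrow> \<bar>x\<bar> > R \<Longrightarrow> \<phi> t x = 0"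
      "\<And>t x. t \<ge> 0 \<Longrightarrow> \<bar>x\<bar> > R \<Longrightarrow> partial_t \<phi> t x = 0"
      "\<And>t x. t \<ge> 0 \<Longrightarrow> \<bar>x\<bar> > R \<Longrightarrow> partial_x \<phi> t x = 0"
    using test_function_props[OF \<phi> T(1)] by metis
  let ?e = "\<lambda>z::real \<times> real. exp (- \<bar>snd z - c * fst z\<bar>)"
  have e: "\<bar>p * ?e z ^ k\<bar> \<le> \<bar>p\<bar>" for p k z
    by (simp add: abs_mult mult_left_le exp_minus_abs_power_le)
  note e' = e[of _ _ 1, unfolded power_one_right]
  have comb: "\<bar>p * ?e z + q * ?e z ^ m\<bar> \<le> \<bar>p\<bar> + \<bar>q\<bar>" for p q z
    using e'[of p z] e[of q z m] by linarith
  have "set_integrable lborel ({0..<T} \<times> UNIV) (\<lambda>z. (a * ?e z) * (case z of (t, x) \<Rightarrow> partial_t \<phi> t x))"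
  proof (rule set_integrable_mult_compact_support[OF _ e' cont(2), where R = R])
    show "(\<lambda>z. a * ?e z) \<in> borel_measurable borel"
      unfolding borel_prod[symmetric] by measurable
  qed (simp add: zero)
  moreover have "set_integrable lborel ({0..<T} \<times> UNIV)
      (\<lambda>z. ((c * a - \<kappa>) * ?e z + (\<kappa> * m) * ?e z ^ m) * (case z of (t, x) \<Rightarrow> partial_x \<phi> t x))"
  proof (rule set_integrable_mult_compact_support[OF _ comb cont(3), where R = R])
    show "(\<lambda>z. (c * a - \<kappa>) * ?e z + (\<kappa> * m) * ?e z ^ m) \<in> borel_measurable borel"
      unfolding borel_prod[symmetric] by measurable
  qed (simp add: zero)
  moreover have "set_integrable lborel ({0..<T} \<times> UNIV)
      (\<lambda>z. (side (snd z - c * fst z) * (\<kappa> * ?e z + (- \<kappa> * real m ^ 2) * ?e z ^ m)) * (case z of (t, x) \<Rightarrow> \<phi> t x))"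
  proof (rule set_integrable_mult_compact_support[OF _ _ cont(1), where R = R])
    show "(\<lambda>z. side (snd z - c * fst z) * (\<kappa> * ?e z + (- \<kappa> * real m ^ 2) * ?e z ^ m)) \<in> borel_measurable borel"
      unfolding borel_prod[symmetric] by measurable
    show "\<bar>side (snd z - c * fst z) * (\<kappa> * ?e z + (- \<kappa> * real m ^ 2) * ?e z ^ m)\<bar>
        \<le> \<bar>\<kappa>\<bar> + \<bar>- \<kappa> * real m ^ 2\<bar>" for z
      unfolding abs_mult[of "side _"] abs_side mult_1 by (rule comb)
  qed (simp add: zero)
  ultimately show ?thesis
    by (rule set_integral_add(1)[OF set_integral_add(1), THEN back_subst[where P = "set_integrable _ _"]])
      (auto simp: fun_eq_iff algebra_simps)
qed

theorem proposition1p1: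
  fixes n :: nat and a c :: real
  assumes "n \<ge> 1"
    and "c = (1 + 1 / (2 * real n)) *
           (\<Sum>k = 0..n. (-1) ^ k / (2 * real k + 1) * real (n choose k) * a ^ (2 * n - 1))"
  shows "global_weak_solution n (\<lambda>x. a * exp (- \<bar>x\<bar>)) (\<lambda>t x. a * exp (- \<bar>x - c * t\<bar>))"
proof -
  let ?u = "\<lambda>t x. a * exp (- \<bar>x - c * t\<bar>)"
  \<comment> \<open>Off the crest this is the classical derivative; the value chosen at the crest
    keeps the square of \<open>?v\<close> equal to that of \<open>?u\<close> everywhere.\<close>
  let ?v = "\<lambda>t x. - side (x - c * t) * (a * exp (- \<bar>x - c * t\<bar>))"
  \<comment> \<open>The sum in the speed is I(n + 1), and its prefactor (2 n + 1)/(2 n) turns it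
    into I(n).\<close>
  have "(1 + 1 / (2 * real n)) * (\<Sum>k = 0..n. (-1) ^ k / (2 * real k + 1) * real (n choose k)) = peakon_sum n"
    using peakon_sum_recurrence[OF assms(1)] assms(1) by (simp add: field_simps)
  then have c: "c = peakon_sum n * a ^ (2 * n - 1)"
    unfolding assms(2) sum_distrib_right[symmetric] by (simp only: mult.assoc[symmetric])
  note integrand = weak_integrand_peakon[OF assms(1) c]
  show ?thesis
    unfolding global_weak_solution_def weak_solution_def
  proof (intro allI impI conjI exI[of _ ?v])
    fix T :: real assume T: "T > 0"
    show "sobolev_W1 (2 * n) (\<lambda>x. a * exp (- \<bar>x\<bar>))"
      using assms(1) by (intro sobolev_W1_peakon) simp
    show "Linf_loc_W1_loc (2 * n) T ?u ?v"
      using assms(1) by (intro Linf_loc_W1_loc_peakon) simp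
    show "AE t in lborel. t \<in> {0..<T} \<longrightarrow>
           convolution_exists peak_kernel (\<lambda>y. nonlin_F n (?u t y) (?v t y)) \<and>
           convolution_exists peak_kernel (\<lambda>y. nonlin_S n (?u t y) (?v t y))"
      using convolution_exists_peakon[OF assms(1)] by simp
    fix \<phi> assume \<phi>: "Cc_infinity_spacetime T \<phi>"
    show "set_integrable lborel ({0..<T} \<times> UNIV) (\<lambda>(t, x). weak_integrand n ?u ?v \<phi> t x)"
      unfolding integrand by (rule set_integrable_peakon_integrand[OF \<phi> T])
    have "(LBINT t:{0..<T}. (LBINT x. weak_integrand n ?u ?v \<phi> t x)) =
        (LBINT t:{0..<T}. (LBINT x. ?u t x * (partial_t \<phi> t x + c * partial_x \<phi> t x)))"
      unfolding integrand by (intro set_lebesgue_integral_cong allI impI integral_slice[OF \<phi> T]) auto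
    then show "(LBINT t:{0..<T}. (LBINT x. weak_integrand n ?u ?v \<phi> t x))
        + (LBINT x. a * exp (- \<bar>x\<bar>) * \<phi> 0 x) = 0"
      using integral_transport[OF \<phi> T, of a c] by simp
  qed
qed

end
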